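(* Let $d,n\ge1$ and let $H^{(1)},\dots,H^{(n)}$ be $d\times d$ Hadamard matrices (possibly distinct). Let $\Delta_n:\mathbb{C}^d\to(\mathbb{C}^d)^{\otimes n}$ be the linear map $|r\rangle\mapsto|r\rangle^{\otimes n}$. Then the isometry $$i:\mathbb{C}^d\to(\mathbb{C}^d)^{\otimes n^2},\qquad i\,|k\rangle=\Delta_nH^{(1)}|k\rangle\otimes\Delta_nH^{(2)}|k\rangle\otimes\cdots\otimes\Delta_nH^{(n)}|k\rangle\quad(0\le k\le d-1)$$ gives an $[[n^2,1,n]]^{U(d)}_d$ code; that is, for every $(n,U(d))$-local operator $e$ on $(\mathbb{C}^d)^{\otimes n^2}$ the composite $i^\dagger\circ e\circ i$ is proportional to the identity on $\mathbb{C}^d$.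
   Context: A Hadamard matrix here is a unitary matrix all of whose entries have the same absolute value. For a subgroup $\mathcal E\subseteq U(d)$, an operator $e$ on $(\mathbb{C}^d)^{\otimes N}$ is $(p,\mathcal E)$-local when $e=U_1\otimes\cdots\otimes U_N$ with all $U_i\in\mathcal E$ and at most $p-1$ of the $U_i$ different from the identity. By the Knill–Laflamme theorem, an isometry $i:(\mathbb{C}^d)^{\otimes k}\to(\mathbb{C}^d)^{\otimes N}$ gives an $[[N,k,p]]^{\mathcal E}_d$ code exactly when $i^\dagger\circ e\circ i$ is proportional to the identity (any factor allowed, including $0$) for every $(p,\mathcal E)$-local $e$; this is taken as the criterion here. *)

theory Defs
  imports "HOL-Analysis.Analysis"
begin

text \<open>
  The space \<open>\<complex>\<^sup>d\<close> is \<open>complex ^ 'd\<close> with \<open>d = CARD('d)\<close>. Its tensor power over a finite set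
  \<open>'i\<close> of tensor positions is \<open>complex ^ ('i \<Rightarrow> 'd)\<close>: the coordinate at \<open>x :: 'i \<Rightarrow> 'd\<close> is the
  coefficient of the basis vector that has \<open>|x p\<rangle>\<close> in position \<open>p\<close>. Linear maps are matrices
  with respect to these orthonormal bases.
\<close>

abbreviation ket :: "'a::finite \<Rightarrow> complex ^ 'a" where
  "ket k \<equiv> axis k 1"

definition linear_extension :: "('a::finite \<Rightarrow> complex ^ 'b::finite) \<Rightarrow> complex ^ 'a ^ 'b" where
  "linear_extension f = (\<chi> x k. f k $ x)"

lemma linear_extension_ket: "linear_extension f *v ket k = f k"
  by (simp add: linear_extension_def matrix_vector_mult_def axis_def vec_eq_iff
      if_distrib [where f = "(*) _"] cong: if_cong)

definition hermitian_adjoint :: "complex ^ 'a::finite ^ 'b::finite \<Rightarrow> complex ^ 'b ^ 'a" where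
  "hermitian_adjoint A = (\<chi> x y. cnj (A $ y $ x))"

definition unitary_group :: "(complex ^ 'd::finite ^ 'd) set" where
  "unitary_group =
     {U. hermitian_adjoint U ** U = mat 1 \<and> U ** hermitian_adjoint U = mat 1}"

definition hadamard :: "complex ^ 'd::finite ^ 'd \<Rightarrow> bool" where
  "hadamard H \<longleftrightarrow> H \<in> unitary_group \<and> (\<exists>c. \<forall>r s. cmod (H $ r $ s) = c)"

definition isometry :: "complex ^ 'a::finite ^ 'b::finite \<Rightarrow> bool" where
  "isometry V \<longleftrightarrow> hermitian_adjoint V ** V = mat 1"

definition tensor_vec :: "('i::finite \<Rightarrow> complex ^ 'a::finite) \<Rightarrow> complex ^ ('i \<Rightarrow> 'a)" where
  "tensor_vec v = (\<chi> x. \<Prod>p\<in>UNIV. v p $ x p)"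

definition tensor_op ::
    "('i::finite \<Rightarrow> complex ^ 'd::finite ^ 'd) \<Rightarrow> complex ^ ('i \<Rightarrow> 'd) ^ ('i \<Rightarrow> 'd)" where
  "tensor_op U = (\<chi> x y. \<Prod>p\<in>UNIV. U p $ x p $ y p)"

text \<open>
  The canonical identification of a tensor product of tensor powers with a single tensor power;
  position \<open>(j, a)\<close> is position \<open>a\<close> of block \<open>j\<close>.
\<close>

definition tensor_flatten ::
    "complex ^ ('i::finite \<Rightarrow> 'j::finite \<Rightarrow> 'd::finite) \<Rightarrow> complex ^ ('i \<times> 'j \<Rightarrow> 'd)" where
  "tensor_flatten w = (\<chi> x. w $ curry x)"

text \<open>
  The bound \<open>p - 1\<close> on the number of non-identity factors is written \<open>< p\<close> because subtraction
  on \<open>nat\<close> truncates. The set \<open>E\<close> stands for a subgroup of the unitary group.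
\<close>

definition local_operator ::
    "nat \<Rightarrow> (complex ^ 'd::finite ^ 'd) set \<Rightarrow> complex ^ ('i::finite \<Rightarrow> 'd) ^ ('i \<Rightarrow> 'd) \<Rightarrow> bool" where
  "local_operator p E e \<longleftrightarrow>
     (\<exists>U. (\<forall>q. U q \<in> E) \<and> card {q. U q \<noteq> mat 1} < p \<and> e = tensor_op U)"

text \<open>
  \<open>[[N, k, p]]\<close> code for \<open>E\<close>, by the Knill--Laflamme criterion. The domain is any space
  \<open>complex ^ 'a\<close> of dimension \<open>d ^ k\<close>, so that \<open>\<complex>\<^sup>d\<close> itself can serve as its first tensor power.
\<close>

definition quantum_code ::
    "nat \<Rightarrow> nat \<Rightarrow> nat \<Rightarrow> (complex ^ 'd::finite ^ 'd) set
       \<Rightarrow> complex ^ 'a::finite ^ ('i::finite \<Rightarrow> 'd) \<Rightarrow> bool" where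
  "quantum_code N k p E V \<longleftrightarrow>
     CARD('i) = N \<and> CARD('a) = CARD('d) ^ k \<and> isometry V \<and>
     (\<forall>e. local_operator p E e \<longrightarrow> (\<exists>c. hermitian_adjoint V ** e ** V = mat c))"

definition copy_map :: "complex ^ 'd::finite ^ ('n::finite \<Rightarrow> 'd)" where
  "copy_map = linear_extension (\<lambda>r. tensor_vec (\<lambda>_. ket r))"

definition hadamard_encoding ::
    "('n::finite \<Rightarrow> complex ^ 'd::finite ^ 'd) \<Rightarrow> complex ^ 'd ^ ('n \<times> 'n \<Rightarrow> 'd)" where
  "hadamard_encoding H =
     linear_extension (\<lambda>k. tensor_flatten (tensor_vec (\<lambda>j. copy_map *v (H j *v ket k))))"

end

(*
  Conjugating a product operator U by the encoding gives a matrix whose entries factor over the n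
  blocks. If fewer than n factors of U are nontrivial, some block carries only identities, and its
  contribution is H\<dagger>H, the identity. Every other block still contains an identity factor, so what it
  contributes has the form H\<dagger>DH with D diagonal; since the entries of H have equal modulus, all
  diagonal entries of this matrix coincide. The entrywise product is therefore scalar.
*)
theory Submission
  imports Defs
begin

lemma prod_sum_UNIV:
  fixes f :: "'i::finite \<Rightarrow> 'a::finite \<Rightarrow> 'b::comm_semiring_1"
  shows "(\<Prod>j\<in>UNIV. \<Sum>r\<in>UNIV. f j r) = (\<Sum>s\<in>UNIV. \<Prod>j\<in>UNIV. f j (s j))"
  by (simp add: prod_sum_PiE)

lemma prod_of_bool_all:
  fixes P :: "'i::finite \<Rightarrow> bool"
  shows "(\<Prod>i\<in>UNIV. of_bool (P i) :: 'b::comm_semiring_1) = of_bool (\<forall>i. P i)"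
proof (cases "\<forall>i. P i")
  case False
  then obtain i where "\<not> P i" by blast
  then have "(\<Prod>i\<in>UNIV. of_bool (P i) :: 'b) = 0"
    by (subst prod.remove [of _ i]) auto
  with False show ?thesis by simp
qed simp

lemma mat_1_nth: "(mat 1 :: 'b::semiring_1 ^ 'a ^ 'a) $ r $ s = of_bool (r = s)"
  by (simp add: mat_def)

lemma copy_map_mult_nth:
  "(copy_map *v v) $ y = (\<Sum>r\<in>UNIV. v $ r * of_bool (\<forall>a. y a = r))"
  by (auto simp: copy_map_def linear_extension_def matrix_vector_mult_def tensor_vec_def
      axis_def mult.commute prod_of_bool_all simp flip: of_bool_def intro!: sum.cong)

lemma matrix_vector_mult_ket: "A *v ket k = (\<chi> r. A $ r $ k)"
  for A :: "complex ^ 'a::finite ^ 'b::finite"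
  by (simp add: matrix_vector_mult_def axis_def vec_eq_iff
      if_distrib [where f = "(*) _"] cong: if_cong)

text \<open>Each copy map forces its block to be constant, so only strings
  \<open>s \<circ> fst\<close> carry amplitude, where \<open>s j\<close> is the common value on
  block \<open>j\<close>. Distributivity turns the product over blocks into a sum over all such
  \<open>s\<close>.\<close>

lemma hadamard_encoding_nth:
  fixes H :: "'n::finite \<Rightarrow> complex ^ 'd::finite ^ 'd"
  shows "hadamard_encoding H $ x $ k =
    (\<Sum>s\<in>UNIV. (\<Prod>j\<in>UNIV. H j $ s j $ k) * of_bool (x = s \<circ> fst))"
proof -
  have eq: "(\<forall>j a. x (j, a) = s j) \<longleftrightarrow> x = s \<circ> fst" for s
    by (auto simp: fun_eq_iff)
  have "hadamard_encoding H $ x $ k =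
      (\<Prod>j\<in>UNIV. \<Sum>r\<in>UNIV. H j $ r $ k * of_bool (\<forall>a. x (j, a) = r))"
    by (simp add: hadamard_encoding_def linear_extension_def tensor_flatten_def tensor_vec_def
        copy_map_mult_nth matrix_vector_mult_ket curry_def)
  also have "\<dots> = (\<Sum>s\<in>UNIV. (\<Prod>j\<in>UNIV. H j $ s j $ k) * of_bool (x = s \<circ> fst))"
    by (simp only: prod_sum_UNIV prod.distrib prod_of_bool_all eq)
  finally show ?thesis .
qed

text \<open>Collapses a sum over all basis strings to the block-constant ones, with
  \<open>h s = s \<circ> fst\<close>; it serves once on each side of the conjugated
  operator.\<close>

lemma sum_mult_sum_of_bool:
  fixes g :: "'a::finite \<Rightarrow> complex" and F :: "'s::finite \<Rightarrow> complex"
  shows "(\<Sum>x\<in>UNIV. g x * (\<Sum>s\<in>UNIV. F s * of_bool (x = h s))) = (\<Sum>s\<in>UNIV. g (h s) * F s)"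
proof -
  have "(\<Sum>x\<in>UNIV. g x * (\<Sum>s\<in>UNIV. F s * of_bool (x = h s))) =
      (\<Sum>s\<in>UNIV. \<Sum>x\<in>UNIV. g x * F s * of_bool (x = h s))"
    by (subst sum.swap) (simp only: sum_distrib_left mult.assoc)
  then show ?thesis by simp
qed

text \<open>The entrywise (Schur) product of the factors in block \<open>j\<close>. It is the
  compression of their tensor product by the copy map, since both basis strings involved are
  constant on the block.\<close>

definition block_matrix ::
    "('n::finite \<times> 'n \<Rightarrow> complex ^ 'd::finite ^ 'd) \<Rightarrow> 'n \<Rightarrow> complex ^ 'd ^ 'd" where
  "block_matrix U j = (\<chi> r t. \<Prod>a\<in>UNIV. U (j, a) $ r $ t)"

lemma hadamard_encoding_conjugate_nth:
  fixes H :: "'n::finite \<Rightarrow> complex ^ 'd::finite ^ 'd"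
  shows "(hermitian_adjoint (hadamard_encoding H) ** tensor_op U ** hadamard_encoding H) $ k $ l =
    (\<Prod>j\<in>UNIV. (hermitian_adjoint (H j) ** block_matrix U j ** H j) $ k $ l)"
proof -
  let ?V = "hadamard_encoding H"
  \<comment> \<open>Between block-constant strings, the product over all positions regroups block by
    block.\<close>
  have U: "tensor_op U $ (s \<circ> fst) $ (t \<circ> fst) = (\<Prod>j\<in>UNIV. block_matrix U j $ s j $ t j)" for s t
    by (simp add: tensor_op_def block_matrix_def prod.cartesian_product case_prod_beta)
  have "(hermitian_adjoint ?V ** tensor_op U) $ k $ y =
      (\<Sum>s\<in>UNIV. tensor_op U $ (s \<circ> fst) $ y * (\<Prod>j\<in>UNIV. cnj (H j $ s j $ k)))" for y
  proof -
    have cnj_V: "hermitian_adjoint ?V $ k $ x =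
        (\<Sum>s\<in>UNIV. (\<Prod>j\<in>UNIV. cnj (H j $ s j $ k)) * of_bool (x = s \<circ> fst))" for x
      by (simp only: hermitian_adjoint_def hadamard_encoding_nth vec_lambda_beta cnj_sum cnj_prod
          complex_cnj_mult of_bool_def if_distrib [where f = cnj] complex_cnj_one complex_cnj_zero)
    have "(hermitian_adjoint ?V ** tensor_op U) $ k $ y =
        (\<Sum>x\<in>UNIV. tensor_op U $ x $ y * hermitian_adjoint ?V $ k $ x)"
      by (simp add: matrix_matrix_mult_def mult.commute)
    then show ?thesis
      by (simp only: cnj_V sum_mult_sum_of_bool)
  qed
  then have "(hermitian_adjoint ?V ** tensor_op U ** ?V) $ k $ l =
      (\<Sum>t\<in>UNIV. (\<Sum>s\<in>UNIV. tensor_op U $ (s \<circ> fst) $ (t \<circ> fst) * (\<Prod>j\<in>UNIV. cnj (H j $ s j $ k)))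
        * (\<Prod>j\<in>UNIV. H j $ t j $ l))"
    by (subst matrix_matrix_mult_def)
      (simp only: hadamard_encoding_nth sum_mult_sum_of_bool vec_lambda_beta)
  \<comment> \<open>Distributivity read backwards: first the sum over \<open>s\<close> for fixed
    \<open>t\<close>, then the sum over \<open>t\<close>, becomes a product over blocks of sums over
    single indices.\<close>
  also have "\<dots> = (\<Sum>t\<in>UNIV. (\<Prod>j\<in>UNIV. \<Sum>r\<in>UNIV. block_matrix U j $ r $ t j * cnj (H j $ r $ k))
        * (\<Prod>j\<in>UNIV. H j $ t j $ l))"
    by (simp only: U prod_sum_UNIV prod.distrib)
  also have "\<dots> = (\<Prod>j\<in>UNIV. \<Sum>t\<in>UNIV.
        (\<Sum>r\<in>UNIV. block_matrix U j $ r $ t * cnj (H j $ r $ k)) * H j $ t $ l)"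
    by (simp only: prod_sum_UNIV prod.distrib)
  also have "\<dots> = (\<Prod>j\<in>UNIV. (hermitian_adjoint (H j) ** block_matrix U j ** H j) $ k $ l)"
    by (simp add: matrix_matrix_mult_def hermitian_adjoint_def mult.commute)
  finally show ?thesis .
qed

lemma block_matrix_trivial:
  assumes "\<And>a. U (j, a) = mat 1"
  shows "block_matrix U j = mat 1"
  by (simp add: block_matrix_def assms mat_1_nth prod_of_bool_all vec_eq_iff)

text \<open>A Schur product inherits the zeros of each factor, so a single identity makes the whole
  block diagonal.\<close>

lemma block_matrix_offdiagonal:
  assumes "U (j, a) = mat 1" "r \<noteq> t"
  shows "block_matrix U j $ r $ t = 0"
proof -
  have "U (j, a) $ r $ t = 0"
    using assms by (simp add: mat_1_nth)
  then show ?thesis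
    by (auto simp: block_matrix_def)
qed

text \<open>For diagonal \<open>D\<close>, the \<open>k\<close>-th diagonal entry weights each
  \<open>D $ r $ r\<close> by the squared modulus of \<open>H $ r $ k\<close>, which is the same
  constant for every \<open>k\<close>.\<close>

lemma hadamard_conjugate_diagonal:
  fixes H D :: "complex ^ 'd::finite ^ 'd"
  assumes "hadamard H" and D: "\<And>r t. r \<noteq> t \<Longrightarrow> D $ r $ t = 0"
  shows "(hermitian_adjoint H ** D ** H) $ k $ k = (hermitian_adjoint H ** D ** H) $ l $ l"
proof -
  obtain c where c: "\<And>r s. cmod (H $ r $ s) = c"
    using assms by (auto simp: hadamard_def)
  have "(hermitian_adjoint H ** D ** H) $ k $ k = (\<Sum>r\<in>UNIV. D $ r $ r * of_real (c\<^sup>2))" for k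
  proof -
    have "(\<Sum>r\<in>UNIV. cnj (H $ r $ k) * D $ r $ t) = cnj (H $ t $ k) * D $ t $ t" for t
      using D by (subst sum.remove [of _ t]) (auto intro!: sum.neutral)
    then have "(hermitian_adjoint H ** D ** H) $ k $ k =
        (\<Sum>r\<in>UNIV. D $ r $ r * (H $ r $ k * cnj (H $ r $ k)))"
      by (simp add: matrix_matrix_mult_def hermitian_adjoint_def mult_ac)
    then show ?thesis
      by (simp only: complex_norm_square [symmetric] c)
  qed
  then show ?thesis by simp
qed

lemma hadamard_adjoint_mult: "hadamard H \<Longrightarrow> hermitian_adjoint H ** H = mat 1"
  by (simp add: hadamard_def unitary_group_def)

lemma hadamard_encoding_knill_laflamme:
  fixes H :: "'n::finite \<Rightarrow> complex ^ 'd::finite ^ 'd"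
  assumes H: "\<And>j. hadamard (H j)" and U: "card {q. U q \<noteq> mat 1} < CARD('n)"
  shows "\<exists>c. hermitian_adjoint (hadamard_encoding H) ** tensor_op U ** hadamard_encoding H = mat c"
proof -
  let ?S = "{q. U q \<noteq> mat 1}"
  let ?M = "\<lambda>j. hermitian_adjoint (H j) ** block_matrix U j ** H j"
  \<comment> \<open>The positions form an n by n grid. Fewer than n of them cannot meet every block,
    which yields the untouched block \<open>j0\<close>.\<close>
  have "fst ` ?S \<noteq> UNIV"
    using U card_image_le [of ?S fst] by auto
  then obtain j0 where j0: "j0 \<notin> fst ` ?S" by blast
  have "U (j0, a) = mat 1" for a
    using j0 by force
  then have M0: "?M j0 = mat 1"
    by (simp add: block_matrix_trivial hadamard_adjoint_mult H)
  have diag: "?M j $ k $ k = ?M j $ l $ l" for j k l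
  proof -
    \<comment> \<open>The same count for the other coordinate gives an index \<open>a\<close> at
      which every block, in particular block \<open>j\<close>, has an identity factor.\<close>
    have "snd ` ?S \<noteq> UNIV"
      using U card_image_le [of ?S snd] by auto
    then obtain a where "a \<notin> snd ` ?S" by blast
    then have "U (j, a) = mat 1" by force
    then show ?thesis
      by (intro hadamard_conjugate_diagonal H block_matrix_offdiagonal)
  qed
  \<comment> \<open>An arbitrary reference index: by \<open>diag\<close> every choice gives the same
    scalar.\<close>
  define k0 :: 'd where "k0 = undefined"
  have "(\<Prod>j\<in>UNIV. ?M j $ k $ l) = mat (\<Prod>j\<in>UNIV. ?M j $ k0 $ k0) $ k $ l" for k l
  proof (cases "k = l")
    case True
    then show ?thesis by (simp add: mat_def diag [of _ l k0])
  next
    case False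
    then have "?M j0 $ k $ l = 0" by (simp add: M0 mat_1_nth)
    then have "(\<Prod>j\<in>UNIV. ?M j $ k $ l) = 0" by (intro prod_zero) auto
    with False show ?thesis by (simp add: mat_def)
  qed
  then have "hermitian_adjoint (hadamard_encoding H) ** tensor_op U ** hadamard_encoding H =
      mat (\<Prod>j\<in>UNIV. ?M j $ k0 $ k0)"
    unfolding vec_eq_iff hadamard_encoding_conjugate_nth by blast
  then show ?thesis ..
qed

text \<open>This is the conjugation formula with the identity in every position: each block
  contributes an identity matrix, and so does their entrywise product.\<close>

lemma isometry_hadamard_encoding:
  fixes H :: "'n::finite \<Rightarrow> complex ^ 'd::finite ^ 'd"
  assumes "\<And>j. hadamard (H j)"
  shows "isometry (hadamard_encoding H)"
proof -
  let ?I = "\<lambda>_ :: 'n \<times> 'n. mat 1 :: complex ^ 'd ^ 'd"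
  have "tensor_op ?I = mat 1"
    by (simp add: tensor_op_def vec_eq_iff mat_1_nth prod_of_bool_all fun_eq_iff)
  with hadamard_encoding_conjugate_nth [of H ?I] show ?thesis
    by (simp add: isometry_def vec_eq_iff block_matrix_trivial hadamard_adjoint_mult assms
        mat_1_nth)
qed

theorem mainTheorem8:
  fixes H :: "'n::finite \<Rightarrow> complex ^ 'd::finite ^ 'd"
  assumes "\<And>j. hadamard (H j)"
  shows "quantum_code (CARD('n) ^ 2) 1 CARD('n) unitary_group (hadamard_encoding H)"
  using assms hadamard_encoding_knill_laflamme [of H]
  by (auto simp: quantum_code_def local_operator_def isometry_hadamard_encoding power2_eq_square)

end
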